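(* Let $A>0$, $B>0$, $c>0$, and put $M=A/B$, $\delta=c/B$. With inverse demand $P(Q)=A-BQ$ and quadratic costs $C_i(x_i)=cx_i^2$ for every firm, let $Q_n^{S,Q}$ denote the aggregate output in the subgame-perfect equilibrium of the $n$-firm canonical hierarchical Stackelberg model, and let $q_n=Q_n^{S,Q}/M$ for $n\ge0$. Then the normalized aggregate output satisfies $q_0=0$ and $$q_n=q_{n-1}+\frac{(1-q_{n-1})^2}{2(1-q_{n-1}+\delta)},\qquad n\ge1.$$ Equivalently, $Q_n^{S,Q}=Mq_n$ with this sequence $(q_n)$. In particular, $$q_1=\frac{1}{2(1+\delta)}\qquad\text{and}\qquad Q_1^{S,Q}=\frac{A}{2(B+c)}.$$
   Context: Canonical hierarchical Stackelberg model. Firms $1,\dots,n$ produce a homogeneous good and choose outputs $x_i\ge0$ sequentially in the order $1,2,\dots,n$; each firm observes the outputs of all its predecessors. With $Q=\sum_{j=1}^n x_j$, firm $i$'s payoff is $\Pi_i(x_1,\dots,x_n)=x_i(A-BQ)-C_i(x_i)$. A strategy of firm $k$ is a function $\sigma_k:[0,\infty)^{k-1}\to[0,\infty)$ of the history $(x_1,\dots,x_{k-1})$. The profile $(\sigma_1,\dots,\sigma_n)$ is a subgame-perfect equilibrium if for every $k$ and every history, $\sigma_k(x_1,\dots,x_{k-1})$ maximizes firm $k$'s payoff over $x_k\ge0$ when all later firms follow $\sigma_{k+1},\dots,\sigma_n$. The equilibrium outputs are those generated along the path, $x_k=\sigma_k(x_1,\dots,x_{k-1})$, and the aggregate equilibrium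 output is their sum. For $n=0$ there are no firms and the aggregate output is $0$. *)

theory Defs
  imports Complex_Main "HOL-Library.FuncSet"
begin

text \<open>
  Output vectors and histories are lists: firm \<open>k\<close> (counted from 1) sits at list position
  \<open>k - 1\<close>, and its history is the list of the outputs of firms \<open>1, \<dots>, k - 1\<close>.
\<close>

definition histories :: "nat \<Rightarrow> real list set" where
  "histories m = {h. length h = m \<and> set h \<subseteq> {0..}}"

text \<open>
  Extensional function spaces make each strategy a function on exactly the set of histories
  of its firm, so that equality of profiles is equality of the strategies as such functions.
\<close>

definition strategy_profiles :: "nat \<Rightarrow> (nat \<Rightarrow> real list \<Rightarrow> real) set" where
  "strategy_profiles n = (\<Pi>\<^sub>E k\<in>{1..n}. histories (k - 1) \<rightarrow>\<^sub>E {0..})"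

definition payoff ::
  "real \<Rightarrow> real \<Rightarrow> (nat \<Rightarrow> real \<Rightarrow> real) \<Rightarrow> real list \<Rightarrow> nat \<Rightarrow> real" where
  "payoff A B C xs i =
     xs ! (i - 1) * (A - B * sum_list xs) - C i (xs ! (i - 1))"

text \<open>\<open>play_on \<sigma> m h\<close> extends the history \<open>h\<close> by the moves of the next \<open>m\<close> firms under \<open>\<sigma>\<close>.\<close>

primrec play_on :: "(nat \<Rightarrow> real list \<Rightarrow> real) \<Rightarrow> nat \<Rightarrow> real list \<Rightarrow> real list" where
  "play_on \<sigma> 0 h = h"
| "play_on \<sigma> (Suc m) h = play_on \<sigma> m (h @ [\<sigma> (Suc (length h)) h])"

definition subgame_perfect ::
  "real \<Rightarrow> real \<Rightarrow> (nat \<Rightarrow> real \<Rightarrow> real) \<Rightarrow> nat \<Rightarrow> (nat \<Rightarrow> real list \<Rightarrow> real) \<Rightarrow> bool" where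
  "subgame_perfect A B C n \<sigma> \<longleftrightarrow>
     \<sigma> \<in> strategy_profiles n \<and>
     (\<forall>k\<in>{1..n}. \<forall>h\<in>histories (k - 1).
        is_arg_max (\<lambda>y. payoff A B C (play_on \<sigma> (n - k) (h @ [y])) k) (\<lambda>y. 0 \<le> y) (\<sigma> k h))"

definition path_outputs :: "nat \<Rightarrow> (nat \<Rightarrow> real list \<Rightarrow> real) \<Rightarrow> real list" where
  "path_outputs n \<sigma> = play_on \<sigma> n []"

text \<open>Meaningful only when there is exactly one subgame-perfect equilibrium.\<close>

definition stackelberg_output ::
  "real \<Rightarrow> real \<Rightarrow> (nat \<Rightarrow> real \<Rightarrow> real) \<Rightarrow> nat \<Rightarrow> real" where
  "stackelberg_output A B C n = sum_list (path_outputs n (THE \<sigma>. subgame_perfect A B C n \<sigma>))"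

end

theory Submission
  imports Defs
begin

text \<open>
  The game is solved by backward induction, and what makes this tractable is that the only
  aspect of a history that matters is the gap \<open>R = A / B - \<Sum>h\<close> it leaves to the competitive
  output \<open>A / B\<close> at which the price vanishes. Suppose the last \<open>m\<close> firms, when facing a gap
  \<open>R \<ge> 0\<close>, jointly shrink it to \<open>t\<^sub>m R\<close>, and stay out when \<open>R \<le> 0\<close>. The firm moving just before
  them then earns, up to the factor \<open>B\<close>, the profit \<open>y t\<^sub>m (R - y) - \<delta> y\<^sup>2\<close> from an output
  \<open>y \<in> [0, R]\<close>. This is a strictly concave quadratic with maximizer
  \<open>y\<^sup>* = t\<^sub>m R / (2 (t\<^sub>m + \<delta>))\<close>, which lies in \<open>[0, R]\<close>; producing more than \<open>R\<close> makes the price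
  negative. The maximizer is again proportional to the gap, so \<open>m + 1\<close> firms shrink the gap
  by the factor
  \[ t_{m+1} = t_m \Bigl(1 - \frac{t_m}{2 (t_m + \delta)}\Bigr), \]
  and \<open>q\<^sub>m = 1 - t\<^sub>m\<close> turns this into the asserted recursion.

  The best reply is unique after every history, which gives uniqueness of the equilibrium
  (\<open>subgame_perfect_iff\<close>). The two halves of the induction step are \<open>gap_after_play\<close> (what the
  followers do to the gap) and \<open>best_reply_unique\<close> (the optimization of the firm in front of
  them).
\<close>

section \<open>The factor by which the remaining firms shrink the gap\<close>

text \<open>Numbered by the firms still to move, so that it does not depend on the size of the game.\<close>

primrec gap_factor :: "real \<Rightarrow> nat \<Rightarrow> real" where
  "gap_factor \<delta> 0 = 1"
| "gap_factor \<delta> (Suc m) =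
     gap_factor \<delta> m - (gap_factor \<delta> m)\<^sup>2 / (2 * (gap_factor \<delta> m + \<delta>))"

lemma gap_factor_bounds:
  assumes "0 < \<delta>"
  shows "0 < gap_factor \<delta> m \<and> gap_factor \<delta> m \<le> 1"
proof (induction m)
  case 0
  show ?case by simp
next
  case (Suc m)
  let ?t = "gap_factor \<delta> m"
  have "?t\<^sup>2 < ?t * (2 * (?t + \<delta>))"
    using Suc assms by (simp add: power2_eq_square)
  then have "?t\<^sup>2 / (2 * (?t + \<delta>)) < ?t"
    using Suc assms by (simp add: pos_divide_less_eq)
  moreover have "0 \<le> ?t\<^sup>2 / (2 * (?t + \<delta>))"
    using Suc assms by simp
  ultimately show ?case using Suc by simp
qed

text \<open>
  The minimum selects \<open>gap_factor \<delta> m * R\<close> for a positive gap and leaves a negative one, where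
  nobody enters any more, unchanged. Its merit over a case distinction is that either argument
  bounds the final gap from above everywhere, in particular for outputs that overshoot the gap.
\<close>

definition final_gap :: "real \<Rightarrow> nat \<Rightarrow> real \<Rightarrow> real" where
  "final_gap \<delta> m R = min R (gap_factor \<delta> m * R)"

definition best_reply :: "real \<Rightarrow> nat \<Rightarrow> real \<Rightarrow> real" where
  "best_reply \<delta> m R = gap_factor \<delta> m / (2 * (gap_factor \<delta> m + \<delta>)) * max 0 R"

lemma best_reply_nonneg:
  assumes "0 < \<delta>"
  shows "0 \<le> best_reply \<delta> m R"
  using gap_factor_bounds[OF assms, of m] assms by (simp add: best_reply_def)

lemma final_gap_nonneg:
  assumes "0 < \<delta>" and "0 \<le> R"
  shows "final_gap \<delta> m R = gap_factor \<delta> m * R"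
  unfolding final_gap_def using gap_factor_bounds[OF assms(1), of m] assms(2)
  by (intro min.absorb2 mult_left_le_one_le) auto

lemma final_gap_nonpos:
  assumes "0 < \<delta>" and "R \<le> 0"
  shows "final_gap \<delta> m R = R"
proof -
  have "0 \<le> (1 - gap_factor \<delta> m) * (- R)"
    using gap_factor_bounds[OF assms(1), of m] assms(2) by (intro mult_nonneg_nonneg) auto
  then show ?thesis by (simp add: final_gap_def algebra_simps)
qed

lemma best_reply_le_gap:
  assumes "0 < \<delta>" and "0 \<le> R"
  shows "best_reply \<delta> m R \<le> R"
proof -
  have "gap_factor \<delta> m / (2 * (gap_factor \<delta> m + \<delta>)) \<le> 1"
    using gap_factor_bounds[OF assms(1), of m] assms(1) by simp
  from mult_right_mono[OF this assms(2)] show ?thesis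
    using assms(2) by (simp add: best_reply_def max_def)
qed

text \<open>This composition law is what the recursion of \<open>gap_factor\<close> was chosen to satisfy.\<close>

lemma final_gap_Suc:
  assumes "0 < \<delta>"
  shows "final_gap \<delta> m (R - best_reply \<delta> m R) = final_gap \<delta> (Suc m) R"
proof (cases "0 \<le> R")
  case True
  then show ?thesis
    using best_reply_le_gap[OF assms True, of m]
    by (simp add: final_gap_nonneg assms del: gap_factor.simps)
       (simp add: best_reply_def max_def algebra_simps power2_eq_square)
next
  case False
  then have "best_reply \<delta> m R = 0" by (simp add: best_reply_def)
  then show ?thesis using False by (simp add: final_gap_nonpos assms del: gap_factor.simps)
qed

section \<open>The optimization problem of a single firm\<close>

text \<open>
  With \<open>t = gap_factor \<delta> m\<close> and \<open>b = best_reply \<delta> m R\<close>, completing the square gives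
  \<open>y t (R - y) - \<delta> y\<^sup>2 = (t + \<delta>) (b\<^sup>2 - (y - b)\<^sup>2)\<close>. The left-hand side is the profit for
  \<open>y \<le> R\<close> and an upper bound of it for \<open>y > R\<close>, hence \<open>b\<close> beats every other output.
\<close>

lemma best_reply_strict:
  assumes "0 < \<delta>" and "0 \<le> y" and "y \<noteq> best_reply \<delta> m R"
  shows "y * final_gap \<delta> m (R - y) - \<delta> * y\<^sup>2
    < best_reply \<delta> m R * final_gap \<delta> m (R - best_reply \<delta> m R) - \<delta> * (best_reply \<delta> m R)\<^sup>2"
proof (cases "0 \<le> R")
  case True
  define t where "t = gap_factor \<delta> m"
  define b where "b = best_reply \<delta> m R"
  have t: "0 < t" using gap_factor_bounds[OF assms(1)] by (simp add: t_def)
  have tR: "t * R = 2 * (t + \<delta>) * b"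
    using True t assms(1) by (simp add: b_def best_reply_def t_def max_def)
  have square: "z * (t * (R - z)) - \<delta> * z\<^sup>2 = (t + \<delta>) * (b\<^sup>2 - (z - b)\<^sup>2)" for z
  proof -
    have "z * (t * (R - z)) - \<delta> * z\<^sup>2 = z * (t * R) - (t + \<delta>) * z\<^sup>2"
      by (simp add: algebra_simps power2_eq_square)
    then show ?thesis unfolding tR by (simp add: algebra_simps power2_eq_square)
  qed
  have "y * final_gap \<delta> m (R - y) \<le> y * (t * (R - y))"
    using assms(2) by (intro mult_left_mono) (simp_all add: final_gap_def t_def)
  then have "y * final_gap \<delta> m (R - y) - \<delta> * y\<^sup>2 \<le> (t + \<delta>) * (b\<^sup>2 - (y - b)\<^sup>2)"
    using square[of y] by linarith
  also have "\<dots> < (t + \<delta>) * (b\<^sup>2 - (b - b)\<^sup>2)"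
    using t assms(1,3) by (intro mult_strict_left_mono) (simp_all add: b_def)
  also have "\<dots> = b * final_gap \<delta> m (R - b) - \<delta> * b\<^sup>2"
    using best_reply_le_gap[OF assms(1) True, of m] square[of b]
    by (simp add: final_gap_nonneg assms(1) b_def t_def)
  finally show ?thesis by (simp add: b_def)
next
  case False
  then have b: "best_reply \<delta> m R = 0" by (simp add: best_reply_def)
  then have "0 < y" using assms by simp
  moreover from this have "final_gap \<delta> m (R - y) < 0"
    using False by (simp add: final_gap_def min_less_iff_disj)
  ultimately have "y * final_gap \<delta> m (R - y) < 0" by (simp add: mult_pos_neg)
  moreover have "0 \<le> \<delta> * y\<^sup>2" using assms(1) by simp
  ultimately show ?thesis by (simp add: b)
qed

lemma is_arg_max_unique_iff:
  fixes f :: "'a \<Rightarrow> real"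
  assumes "P b" and "\<And>y. P y \<Longrightarrow> y \<noteq> b \<Longrightarrow> f y < f b"
  shows "is_arg_max f P x \<longleftrightarrow> x = b"
  using assms by (metis is_arg_max_def order_less_asym)

lemma best_reply_unique:
  assumes "0 < B" and "0 < c"
  shows "is_arg_max (\<lambda>y. y * (B * final_gap (c / B) m (R - y)) - c * y\<^sup>2) (\<lambda>y. 0 \<le> y) x
    \<longleftrightarrow> x = best_reply (c / B) m R"
proof -
  have \<delta>: "0 < c / B" using assms by simp
  have scale: "y * (B * final_gap (c / B) m (R - y)) - c * y\<^sup>2
    = B * (y * final_gap (c / B) m (R - y) - (c / B) * y\<^sup>2)" for y
    using assms(1) by (simp add: field_simps)
  show ?thesis
    unfolding scale using assms(1)
    by (intro is_arg_max_unique_iff best_reply_nonneg[OF \<delta>] mult_strict_left_mono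
        best_reply_strict[OF \<delta>])
qed

section \<open>Backward induction\<close>

lemma play_on_nth:
  "i < length h \<Longrightarrow> play_on \<sigma> m h ! i = h ! i"
  by (induction m arbitrary: h) (simp_all add: nth_append)

text \<open>
  The hypothesis concerns only the firms that still move, since the claim is applied to the
  followers of a firm whose own strategy is yet to be determined.
\<close>

lemma gap_after_play:
  assumes "0 < \<delta>"
    and "h \<in> histories l"
    and "\<And>k g. l < k \<Longrightarrow> k \<le> l + m \<Longrightarrow> g \<in> histories (k - 1) \<Longrightarrow>
      \<sigma> k g = best_reply \<delta> (l + m - k) (M - sum_list g)"
  shows "M - sum_list (play_on \<sigma> m h) = final_gap \<delta> m (M - sum_list h)"
  using assms(2,3)
proof (induction m arbitrary: h l)
  case 0
  show ?case by (simp add: final_gap_def)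
next
  case (Suc m)
  define x where "x = \<sigma> (Suc (length h)) h"
  have len: "length h = l" using Suc.prems(1) by (simp add: histories_def)
  have x: "x = best_reply \<delta> m (M - sum_list h)"
    using Suc.prems(2)[of "Suc l" h] Suc.prems(1) by (simp add: x_def len)
  have "h @ [x] \<in> histories (Suc l)"
    using Suc.prems(1) best_reply_nonneg[OF assms(1)] by (auto simp: histories_def x)
  then have "M - sum_list (play_on \<sigma> m (h @ [x])) = final_gap \<delta> m (M - sum_list (h @ [x]))"
    using Suc.prems(2) by (intro Suc.IH) auto
  also have "M - sum_list (h @ [x]) = (M - sum_list h) - best_reply \<delta> m (M - sum_list h)"
    by (simp add: x)
  finally show ?case
    by (simp add: final_gap_Suc[OF assms(1)] flip: x_def del: gap_factor.simps)
qed

text \<open>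
  Only the followers are assumed to play their best replies, so the equivalence can be used in
  both directions: to check the candidate profile, and to force an equilibrium to be it.
\<close>

lemma optimal_move_iff:
  fixes A B c :: real
  assumes "0 < B" and "0 < c"
    and k: "k \<in> {1..n}" and h: "h \<in> histories (k - 1)"
    and followers: "\<And>j g. k < j \<Longrightarrow> j \<le> n \<Longrightarrow> g \<in> histories (j - 1) \<Longrightarrow>
      \<sigma> j g = best_reply (c / B) (n - j) (A / B - sum_list g)"
  shows "is_arg_max (\<lambda>y. payoff A B (\<lambda>i x. c * x\<^sup>2) (play_on \<sigma> (n - k) (h @ [y])) k)
      (\<lambda>y. 0 \<le> y) x
    \<longleftrightarrow> x = best_reply (c / B) (n - k) (A / B - sum_list h)"
proof -
  have \<delta>: "0 < c / B" using assms(1,2) by simp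
  have len: "length h = k - 1" using h by (simp add: histories_def)
  let ?u = "\<lambda>y. payoff A B (\<lambda>i x. c * x\<^sup>2) (play_on \<sigma> (n - k) (h @ [y])) k"
  let ?v = "\<lambda>y. y * (B * final_gap (c / B) (n - k) (A / B - sum_list h - y)) - c * y\<^sup>2"
  have u_eq_v: "?u y = ?v y" if "0 \<le> y" for y
  proof -
    have "h @ [y] \<in> histories k"
      using h k that by (auto simp: histories_def)
    then have gap: "A / B - sum_list (play_on \<sigma> (n - k) (h @ [y]))
      = final_gap (c / B) (n - k) (A / B - sum_list h - y)"
      using gap_after_play[OF \<delta>, of "h @ [y]" k "n - k" \<sigma> "A / B"] followers k
      by (simp add: algebra_simps)
    have "play_on \<sigma> (n - k) (h @ [y]) ! (k - 1) = y"
      using play_on_nth[of "k - 1" "h @ [y]" \<sigma> "n - k"] len by (simp add: nth_append)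
    moreover have "A - B * s = B * (A / B - s)" for s
      using assms(1) by (simp add: field_simps)
    ultimately show ?thesis by (simp add: payoff_def gap)
  qed
  have "is_arg_max ?u (\<lambda>y. 0 \<le> y) x \<longleftrightarrow> is_arg_max ?v (\<lambda>y. 0 \<le> y) x"
    unfolding is_arg_max_def using u_eq_v by metis
  then show ?thesis using best_reply_unique[OF assms(1,2)] by simp
qed

text \<open>
  Optimality pins down a firm's moves only once those of its followers are known, so the firms
  are treated from the last one back. The right-hand side prescribes the value of every strategy
  at every history, which is what makes the equilibrium exist and be unique.
\<close>

lemma subgame_perfect_iff:
  fixes A B c :: real
  assumes "0 < B" and "0 < c"
  shows "subgame_perfect A B (\<lambda>i x. c * x\<^sup>2) n \<sigma> \<longleftrightarrow>
    \<sigma> \<in> strategy_profiles n \<and>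
    (\<forall>k\<in>{1..n}. \<forall>h\<in>histories (k - 1).
      \<sigma> k h = best_reply (c / B) (n - k) (A / B - sum_list h))"
    (is "?spe \<longleftrightarrow> ?prof \<and> (\<forall>k\<in>{1..n}. ?rule k)")
proof
  assume ?spe
  have "1 \<le> k \<longrightarrow> ?rule k" if "k \<le> n" for k
    using that
  proof (induction "n - k" arbitrary: k rule: less_induct)
    case less
    have followers: "\<sigma> j g = best_reply (c / B) (n - j) (A / B - sum_list g)"
      if "k < j" "j \<le> n" "g \<in> histories (j - 1)" for j g
      using less.hyps[of j] that by auto
    show ?case
    proof (intro impI ballI)
      fix h
      assume "1 \<le> k" and h: "h \<in> histories (k - 1)"
      then have k: "k \<in> {1..n}" using less.prems by simp
      show "\<sigma> k h = best_reply (c / B) (n - k) (A / B - sum_list h)"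
      proof (rule iffD1[OF optimal_move_iff[OF assms k h]])
        show "is_arg_max (\<lambda>y. payoff A B (\<lambda>i x. c * x\<^sup>2) (play_on \<sigma> (n - k) (h @ [y])) k)
            (\<lambda>y. 0 \<le> y) (\<sigma> k h)"
          using \<open>?spe\<close> k h unfolding subgame_perfect_def by blast
      qed (rule followers)
    qed
  qed
  then show "?prof \<and> (\<forall>k\<in>{1..n}. ?rule k)"
    using \<open>?spe\<close> by (auto simp: subgame_perfect_def)
next
  assume "?prof \<and> (\<forall>k\<in>{1..n}. ?rule k)"
  then show ?spe
    unfolding subgame_perfect_def using optimal_move_iff[OF assms, of _ n _ \<sigma> A] by auto
qed

lemma subgame_perfect_ex1:
  fixes A B c :: real
  assumes "0 < B" and "0 < c"
  shows "\<exists>!\<sigma>. subgame_perfect A B (\<lambda>i x. c * x\<^sup>2) n \<sigma>"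
proof (rule ex1I)
  define s where "s = (\<lambda>k\<in>{1..n}. \<lambda>h\<in>histories (k - 1).
    best_reply (c / B) (n - k) (A / B - sum_list h))"
  have "0 < c / B" using assms by simp
  then have "s \<in> strategy_profiles n"
    by (auto simp: strategy_profiles_def s_def best_reply_nonneg)
  then show s: "subgame_perfect A B (\<lambda>i x. c * x\<^sup>2) n s"
    unfolding subgame_perfect_iff[OF assms] by (auto simp: s_def)
  show "\<sigma> = s" if "subgame_perfect A B (\<lambda>i x. c * x\<^sup>2) n \<sigma>" for \<sigma>
  proof (rule PiE_ext)
    show "\<sigma> \<in> (\<Pi>\<^sub>E k\<in>{1..n}. histories (k - 1) \<rightarrow>\<^sub>E {0..})"
      and "s \<in> (\<Pi>\<^sub>E k\<in>{1..n}. histories (k - 1) \<rightarrow>\<^sub>E {0..})"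
      using that s by (simp_all add: subgame_perfect_def strategy_profiles_def)
    then show "\<sigma> k = s k" if k: "k \<in> {1..n}" for k
    proof (rule PiE_ext[OF PiE_mem[OF _ k] PiE_mem[OF _ k]])
      show "\<sigma> k h = s k h" if "h \<in> histories (k - 1)" for h
        using \<open>subgame_perfect A B (\<lambda>i x. c * x\<^sup>2) n \<sigma>\<close> s k that
        unfolding subgame_perfect_iff[OF assms] by simp
    qed
  qed
qed

lemma stackelberg_output_eq:
  fixes A B c :: real
  assumes "0 < A" and "0 < B" and "0 < c"
  shows "stackelberg_output A B (\<lambda>i x. c * x\<^sup>2) n = A / B * (1 - gap_factor (c / B) n)"
proof -
  define s where "s = (THE \<sigma>. subgame_perfect A B (\<lambda>i x. c * x\<^sup>2) n \<sigma>)"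
  have "subgame_perfect A B (\<lambda>i x. c * x\<^sup>2) n s"
    unfolding s_def using subgame_perfect_ex1[OF assms(2,3)] by (rule theI')
  then have "A / B - sum_list (play_on s n []) = final_gap (c / B) n (A / B - sum_list [])"
    using assms(2,3) unfolding subgame_perfect_iff[OF assms(2,3)]
    by (intro gap_after_play[where l = 0]) (auto simp: histories_def)
  then have "sum_list (play_on s n []) = A / B * (1 - gap_factor (c / B) n)"
    using assms by (simp add: final_gap_nonneg right_diff_distrib mult.commute)
  then show ?thesis by (simp add: stackelberg_output_def path_outputs_def s_def)
qed

section \<open>The recursion for the normalized aggregate output\<close>

theorem theorem7:
  fixes A B c M \<delta> :: real
    and C :: "nat \<Rightarrow> real \<Rightarrow> real"
    and Q q :: "nat \<Rightarrow> real"
  assumes "A > 0" and "B > 0" and "c > 0"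
    and "M = A / B" and "\<delta> = c / B"
    and "C = (\<lambda>i x. c * x\<^sup>2)"
    and "Q = (\<lambda>n. stackelberg_output A B C n)"
    and "q = (\<lambda>n. Q n / M)"
  shows "(\<forall>n. \<exists>!\<sigma>. subgame_perfect A B C n \<sigma>) \<and>
    q 0 = 0 \<and>
    (\<forall>n\<ge>1. q n = q (n - 1) + (1 - q (n - 1))\<^sup>2 / (2 * (1 - q (n - 1) + \<delta>))) \<and>
    (\<forall>r. r 0 = 0 \<and>
         (\<forall>n\<ge>1. r n = r (n - 1) + (1 - r (n - 1))\<^sup>2 / (2 * (1 - r (n - 1) + \<delta>))) \<longrightarrow>
         (\<forall>n. Q n = M * r n)) \<and>
    q 1 = 1 / (2 * (1 + \<delta>)) \<and>
    Q 1 = A / (2 * (B + c))"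
proof -
  have \<delta>: "0 < \<delta>" and M: "0 < M" using assms by simp_all
  have Q: "Q n = M * (1 - gap_factor \<delta> n)" for n
    using stackelberg_output_eq[of A B c n] assms by simp
  have q: "q n = 1 - gap_factor \<delta> n" for n
    using Q[of n] M by (simp add: assms(8))
  have rec: "q n = q (n - 1) + (1 - q (n - 1))\<^sup>2 / (2 * (1 - q (n - 1) + \<delta>))" if "1 \<le> n" for n
    using that by (cases n) (simp_all add: q)
  have unique: "r n = q n"
    if "r 0 = 0"
      and "\<forall>n\<ge>1. r n = r (n - 1) + (1 - r (n - 1))\<^sup>2 / (2 * (1 - r (n - 1) + \<delta>))"
    for r n
  proof (induction n)
    case 0
    show ?case using that(1) by (simp add: q)
  next
    case (Suc n)
    then show ?case using that(2) rec[of "Suc n"] by simp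
  qed
  have q1: "q 1 = 1 / (2 * (1 + \<delta>))" using rec[of 1] by (simp add: q)
  have "Q 1 = M * q 1" using Q q by simp
  also have "\<dots> = A / (2 * (B + c))"
    using assms(1-3) unfolding q1 assms(4,5) by (simp add: field_simps)
  finally have Q1: "Q 1 = A / (2 * (B + c))" .
  have "\<forall>n. \<exists>!\<sigma>. subgame_perfect A B C n \<sigma>"
    using subgame_perfect_ex1[OF assms(2,3)] by (simp add: assms(6))
  moreover have "q 0 = 0" by (simp add: q)
  moreover have "\<forall>r. r 0 = 0 \<and>
      (\<forall>n\<ge>1. r n = r (n - 1) + (1 - r (n - 1))\<^sup>2 / (2 * (1 - r (n - 1) + \<delta>))) \<longrightarrow>
      (\<forall>n. Q n = M * r n)"
  proof (intro allI impI, elim conjE)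
    fix r :: "nat \<Rightarrow> real" and n
    assume "r 0 = 0"
      and "\<forall>n\<ge>1. r n = r (n - 1) + (1 - r (n - 1))\<^sup>2 / (2 * (1 - r (n - 1) + \<delta>))"
    then have "r n = q n" by (rule unique)
    then show "Q n = M * r n" by (simp only: Q q)
  qed
  ultimately show ?thesis using rec q1 Q1 by blast
qed

end
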